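(* Let $X = X(\omega_1)$ be the inverse limit constructed in the context. The trivial composant $E$ of $X$ is non-metrisable.
   Context: A continuum is a nondegenerate compact connected Hausdorff space; a subcontinuum is a subspace that is itself a continuum. The composant $\kappa(x)$ of a point $x$ of a continuum is the union of all proper subcontinua containing $x$. For points $a,b$ of a continuum, $[a,b]$ denotes the intersection of all subcontinua containing $\{a,b\}$. $\mathbb N = \{1,2,\ldots\}$. Construction of $X$. By transfinite recursion one defines, for each $\alpha \le \omega_1$, a continuum $X(\alpha)$, a point $a_\alpha \in X(\alpha)$, a sequence of points $(q^n_\alpha)_{n \in \mathbb N}$ in $X(\alpha)$, and, for each $\beta \le \alpha$, a continuous map $f^\alpha_\beta : X(\alpha) \to X(\beta)$ (with $f^\alpha_\alpha = \mathrm{id}$) together with an embedding of $X(\beta)$ as a subspace of $X(\alpha)$ for which $f^\alpha_\beta$ is a retraction. Stage $0$: $X(0)$ is the $\sin(1/x)$ continuum $\{(x,\sin(1/x)) : -2/\pi \le x < 0\} \cup (\{0\}\times[-1,1])$, $a_0 = (-2/\pi,-1)$, and $(q^n_0)$ is a chosen sequence of points of the graph $\{(x,\sin(1/x)) : -2/\pi < x < 0\}$ whose $x$-coordinates strictly increase to $0$. Successor stage: let $N = \bigcup_{n \in \mathbb N} \big([a_\beta,q^n_\beta] \times \{1/(2n-1), 1/(2n)\}\big) \cup (X(\beta)\times\{0\}) \subset X(\beta)\times[0,1]$. The space $X(\beta+1)$ is the quotient of $N$ obtained by making, for each $n \in \mathbb N$, the identifications $(q^n_\beta, 1/(2n-1))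 \sim (q^n_\beta,1/(2n))$ and $(a_\beta,1/(2n)) \sim (a_\beta, 1/(2n+1))$. $X(\beta)$ is identified with the subspace $X(\beta)\times\{0\}$; $f^{\beta+1}_\beta$ is induced by the projection $X(\beta)\times[0,1]\to X(\beta)$; $f^{\beta+1}_\gamma = f^\beta_\gamma \circ f^{\beta+1}_\beta$ for $\gamma \le \beta$; $a_{\beta+1}$ is the class of $(a_\beta,1)$; and $q^n_{\beta+1}$ is the class of $(q^n_\beta,1/(2n-1))$. Limit stage ($\alpha \le \omega_1$ a limit ordinal): $X(\alpha) = \varprojlim\{X(\beta); f^\beta_\gamma : \gamma \le \beta < \alpha\}$, the maps $f^\alpha_\beta$ are the projections, $a_\alpha = (a_\beta)_{\beta<\alpha}$, $q^n_\alpha = (q^n_\beta)_{\beta<\alpha}$, and for $\gamma<\alpha$ the space $X(\gamma)$ is identified with the subspace $\{x \in X(\alpha) : x_\beta = x_\gamma \text{ for all } \gamma \le \beta < \alpha\}$ (using $X(\gamma)\subset X(\beta)$). $X = X(\omega_1)$ is an indecomposable continuum with exactly two composants: the trivial composant $E = \bigcup\{X(\alpha) : \alpha<\omega_1\}$ and the nontrivial composant $X - E = \varprojlim\{\kappa(a_\alpha); f^\alpha_\beta : \beta \le \alpha<\omega_1\}$. *)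

theory Defs
  imports "HOL-Analysis.Analysis" "HOL-Library.Countable_Set_Type"
begin

section \<open>The ordinals below \<open>\<omega>\<^sub>1\<close>\<close>

typedef omega1 = "Field (cardSuc natLeq)"
  using Field_cardSuc_not_empty[OF natLeq_Card_order] by blast

instantiation omega1 :: wellorder
begin

definition less_eq_omega1 :: "omega1 \<Rightarrow> omega1 \<Rightarrow> bool" where
  "x \<le> y \<longleftrightarrow> (Rep_omega1 x, Rep_omega1 y) \<in> cardSuc natLeq"

definition less_omega1 :: "omega1 \<Rightarrow> omega1 \<Rightarrow> bool" where
  "x < y \<longleftrightarrow> x \<le> y \<and> x \<noteq> y" for x y :: omega1

instance
proof -
  let ?r = "cardSuc natLeq"
  have wo: "Well_order ?r"
    by (rule cardSuc_Well_order[OF natLeq_Card_order])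
  then have refl_r: "refl_on (Field ?r) ?r" and trans_r: "trans ?r" and antisym_r: "antisym ?r"
    and total_r: "total_on (Field ?r) ?r" and wf_r: "wf (?r - Id)"
    by (auto simp: order_on_defs)
  have antis: "x = y" if "x \<le> y" "y \<le> x" for x y :: omega1
    using antisymD[OF antisym_r that[unfolded less_eq_omega1_def]] by (simp add: Rep_omega1_inject)
  have rf: "x \<le> x" for x :: omega1
    using refl_onD[OF refl_r Rep_omega1] by (simp add: less_eq_omega1_def)
  have wf_less: "wf {(x, y :: omega1). x < y}"
    by (rule wf_subset[OF wf_inv_image[OF wf_r, of Rep_omega1]])
       (auto simp: inv_image_def less_omega1_def less_eq_omega1_def Rep_omega1_inject)
  show "OFCLASS(omega1, wellorder_class)"
  proof
    fix x y z :: omega1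
    show "x < y \<longleftrightarrow> x \<le> y \<and> \<not> y \<le> x"
      using antis[of x y] rf[of x] by (auto simp: less_omega1_def)
    show "x \<le> x"
      by (rule rf)
    show "x \<le> y \<Longrightarrow> y \<le> z \<Longrightarrow> x \<le> z"
      unfolding less_eq_omega1_def by (rule transD[OF trans_r])
    show "x \<le> y \<Longrightarrow> y \<le> x \<Longrightarrow> x = y"
      by (rule antis)
    show "x \<le> y \<or> y \<le> x"
      using total_r[unfolded total_on_def, rule_format, OF Rep_omega1[of x] Rep_omega1[of y]] rf[of x]
      by (cases "x = y") (auto simp: less_eq_omega1_def Rep_omega1_inject)
  next
    fix P :: "omega1 \<Rightarrow> bool" and a
    assume step: "\<And>x. (\<And>y. y < x \<Longrightarrow> P y) \<Longrightarrow> P x"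
    show "P a"
      using wf_less by (induction a rule: wf_induct_rule) (rule step, simp)
  qed
qed

end

text \<open>These two facts say that the order type is \<open>\<omega>\<^sub>1\<close>.\<close>

lemma uncountable_omega1:
  includes cardinal_syntax
  shows "uncountable (UNIV :: omega1 set)"
proof
  assume "countable (UNIV :: omega1 set)"
  then have "countable (range Rep_omega1)"
    by simp
  then have "countable (Field (cardSuc natLeq))"
    by (simp add: type_definition.Rep_range[OF type_definition_omega1])
  then have "|Field (cardSuc natLeq)| \<le>o natLeq"
    by (simp add: countable_card_le_natLeq)
  moreover note card_of_Field_ordIso[OF cardSuc_Card_order[OF natLeq_Card_order]]
  ultimately have "cardSuc natLeq \<le>o natLeq"
    using ordIso_ordLeq_trans ordIso_symmetric by blast
  then show False
    using cardSuc_greater[OF natLeq_Card_order] not_ordLess_ordLeq by blast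
qed

lemma countable_lessThan_omega1:
  includes cardinal_syntax
  shows "countable {..<\<alpha> :: omega1}"
proof -
  let ?r = "cardSuc natLeq"
  let ?S = "underS ?r (Rep_omega1 \<alpha>)"
  have "|?S| <o ?r"
    by (rule card_of_underS[OF cardSuc_Card_order[OF natLeq_Card_order] Rep_omega1])
  then have "|?S| \<le>o natLeq"
    using cardSuc_ordLeq_ordLess[OF natLeq_Card_order card_of_Card_order] by blast
  then have "countable ?S"
    by (simp add: countable_card_le_natLeq)
  moreover have "Rep_omega1 ` {..<\<alpha>} \<subseteq> ?S"
    by (auto simp: underS_def less_omega1_def less_eq_omega1_def Rep_omega1_inject)
  ultimately show ?thesis
    using countable_subset countable_image_inj_on
    by (metis Rep_omega1_inject inj_onI)
qed

section \<open>Continua and quotients\<close>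

definition continuum :: "'a topology \<Rightarrow> bool" where
  "continuum T \<longleftrightarrow> compact_space T \<and> connected_space T \<and> Hausdorff_space T \<and>
     (\<exists>x\<in>topspace T. \<exists>y\<in>topspace T. x \<noteq> y)"

definition subcontinuum :: "'a topology \<Rightarrow> 'a set \<Rightarrow> bool" where
  "subcontinuum T K \<longleftrightarrow> K \<subseteq> topspace T \<and> continuum (subtopology T K)"

definition continuum_interval :: "'a topology \<Rightarrow> 'a \<Rightarrow> 'a \<Rightarrow> 'a set" where
  "continuum_interval T a b =
     {x \<in> topspace T. \<forall>K. subcontinuum T K \<and> {a, b} \<subseteq> K \<longrightarrow> x \<in> K}"

definition quot_topology :: "'a topology \<Rightarrow> ('a \<Rightarrow> 'b) \<Rightarrow> 'b topology" where
  "quot_topology T p =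
     topology (\<lambda>U. U \<subseteq> p ` topspace T \<and> openin T {x \<in> topspace T. p x \<in> U})"

lemma openin_quot_topology:
  "openin (quot_topology T p) U \<longleftrightarrow>
     U \<subseteq> p ` topspace T \<and> openin T {x \<in> topspace T. p x \<in> U}"
proof -
  have "istopology (\<lambda>U. U \<subseteq> p ` topspace T \<and> openin T {x \<in> topspace T. p x \<in> U})"
    unfolding istopology_def
  proof (intro conjI allI impI; (elim conjE)?)
    fix S U
    assume "openin T {x \<in> topspace T. p x \<in> S}" "openin T {x \<in> topspace T. p x \<in> U}"
    then have "openin T ({x \<in> topspace T. p x \<in> S} \<inter> {x \<in> topspace T. p x \<in> U})"
      by (rule openin_Int)
    then show "openin T {x \<in> topspace T. p x \<in> S \<inter> U}"
      by (rule back_subst) auto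
  next
    fix \<K>
    assume "\<forall>K\<in>\<K>. K \<subseteq> p ` topspace T \<and> openin T {x \<in> topspace T. p x \<in> K}"
    then have "openin T (\<Union>K\<in>\<K>. {x \<in> topspace T. p x \<in> K})"
      by blast
    then show "openin T {x \<in> topspace T. p x \<in> \<Union>\<K>}"
      by (rule back_subst) auto
  qed auto
  then show ?thesis
    by (simp add: quot_topology_def topology_inverse')
qed

lemma quotient_map_quot_topology: "quotient_map T (quot_topology T p) p"
proof -
  have "topspace (quot_topology T p) = p ` topspace T"
  proof
    show "topspace (quot_topology T p) \<subseteq> p ` topspace T"
      using openin_topspace[of "quot_topology T p"] unfolding openin_quot_topology by blast
    have "{x \<in> topspace T. p x \<in> p ` topspace T} = topspace T"
      by blast
    then show "p ` topspace T \<subseteq> topspace (quot_topology T p)"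
      by (intro openin_subset) (simp add: openin_quot_topology)
  qed
  then show ?thesis
    by (auto simp: quotient_map_def openin_quot_topology)
qed

section \<open>The construction\<close>

text \<open>
  All the spaces live in one type. \<^term>\<open>Cls x S\<close> stands for the equivalence class \<open>{x} \<times> S\<close>
  of a successor stage (the identifications there never change the first coordinate, see
  \<open>glue_fst\<close> below), and \<^term>\<open>Thread x\<close> for a point \<open>x\<close> of an inverse limit. The three
  constructors are injective, so \<^const>\<open>quot_topology\<close> along \<open>Base\<close> and \<open>Thread\<close> is transport
  of structure.
\<close>

datatype pt =
    Base "real \<times> real"
  | Cls (foot: pt) "real set"
  | Thread (coord: "omega1 \<Rightarrow> pt")

text \<open>
  The data at stage \<open>\<alpha>\<close>: the space \<open>X(\<alpha>)\<close>, the point \<open>a\<^sub>\<alpha>\<close>, the points \<open>q\<^sup>n\<^sub>\<alpha>\<close> (for \<open>n \<ge> 1\<close>; the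
  value at \<open>0\<close> is irrelevant), and for \<open>\<beta> \<le> \<alpha>\<close> the retraction \<open>bond \<beta> : X(\<alpha>) \<rightarrow> X(\<beta>)\<close> and the
  embedding \<open>emb \<beta> : X(\<beta>) \<rightarrow> X(\<alpha>)\<close> by which \<open>X(\<beta>)\<close> is regarded as a subspace of \<open>X(\<alpha>)\<close>.
\<close>

record stage =
  space_of :: "pt topology"
  a_of :: pt
  q_of :: "nat \<Rightarrow> pt"
  bond :: "omega1 \<Rightarrow> pt \<Rightarrow> pt"
  emb :: "omega1 \<Rightarrow> pt \<Rightarrow> pt"

definition sin_graph :: "(real \<times> real) set" where
  "sin_graph = {(x, sin (1 / x)) | x. - 2 / pi < x \<and> x < 0}"

definition sin_continuum :: "(real \<times> real) set" where
  "sin_continuum = {(x, sin (1 / x)) | x. - 2 / pi \<le> x \<and> x < 0} \<union> {0} \<times> {-1..1}"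

definition zero_stage :: "(nat \<Rightarrow> real \<times> real) \<Rightarrow> stage" where
  "zero_stage q0 =
     \<lparr>space_of = quot_topology (top_of_set sin_continuum) Base,
      a_of = Base (- 2 / pi, -1),
      q_of = (\<lambda>n. Base (q0 n)),
      bond = (\<lambda>_. id),
      emb = (\<lambda>_. id)\<rparr>"

definition succ_carrier :: "stage \<Rightarrow> (pt \<times> real) set" where
  "succ_carrier s =
     (\<Union>n\<in>{1..}. continuum_interval (space_of s) (a_of s) (q_of s n)
                   \<times> {1 / (2 * real n - 1), 1 / (2 * real n)})
     \<union> topspace (space_of s) \<times> {0}"

definition glue_gen :: "stage \<Rightarrow> ((pt \<times> real) \<times> (pt \<times> real)) set" where
  "glue_gen s =
     {((q_of s n, 1 / (2 * real n - 1)), (q_of s n, 1 / (2 * real n))) | n. n \<ge> 1}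
     \<union> {((a_of s, 1 / (2 * real n)), (a_of s, 1 / (2 * real n + 1))) | n. n \<ge> 1}"

definition glue :: "stage \<Rightarrow> ((pt \<times> real) \<times> (pt \<times> real)) set" where
  "glue s = (glue_gen s \<union> (glue_gen s)\<inverse>)\<^sup>*"

lemma glue_fst: "(p, p') \<in> glue s \<Longrightarrow> fst p' = fst p"
  unfolding glue_def by (induction rule: rtrancl_induct) (auto simp: glue_gen_def)

definition cls :: "stage \<Rightarrow> pt \<times> real \<Rightarrow> pt" where
  "cls s p = Cls (fst p) {t. (p, (fst p, t)) \<in> glue s}"

lemma cls_eq_iff: "cls s p = cls s p' \<longleftrightarrow> (p, p') \<in> glue s"
proof
  assume "cls s p = cls s p'"
  moreover have "(p', (fst p', snd p')) \<in> glue s"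
    by (simp add: glue_def)
  ultimately show "(p, p') \<in> glue s"
    unfolding cls_def pt.inject
    by (metis (mono_tags, lifting) mem_Collect_eq prod.collapse)
next
  assume *: "(p, p') \<in> glue s"
  have "sym (glue s)"
    unfolding glue_def by (simp add: sym_rtrancl sym_Un_converse)
  moreover have "trans (glue s)"
    unfolding glue_def by (rule trans_rtrancl)
  ultimately have "(p, z) \<in> glue s \<longleftrightarrow> (p', z) \<in> glue s" for z
    using * by (meson symD transD)
  then show "cls s p = cls s p'"
    using glue_fst[OF *] by (simp add: cls_def)
qed

text \<open>\<open>succ_stage \<beta> s\<close> is the data at \<open>\<beta> + 1\<close>, where \<open>s\<close> is the data at \<open>\<beta>\<close>.\<close>

definition succ_stage :: "omega1 \<Rightarrow> stage \<Rightarrow> stage" where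
  "succ_stage \<beta> s =
     \<lparr>space_of =
        quot_topology
          (subtopology (prod_topology (space_of s) (top_of_set {0..1})) (succ_carrier s)) (cls s),
      a_of = cls s (a_of s, 1),
      q_of = (\<lambda>n. cls s (q_of s n, 1 / (2 * real n - 1))),
      bond = (\<lambda>\<gamma>. if \<gamma> \<le> \<beta> then bond s \<gamma> \<circ> foot else id),
      emb = (\<lambda>\<gamma>. if \<gamma> \<le> \<beta> then (\<lambda>x. cls s (emb s \<gamma> x, 0)) else id)\<rparr>"

text \<open>
  The inverse limit of the stages \<open>F \<beta>\<close> for \<open>\<beta>\<close> in an initial segment \<open>A\<close> of the countable
  ordinals: \<open>A = {..<\<alpha>}\<close> gives \<open>X(\<alpha>)\<close> for a countable limit \<open>\<alpha>\<close>, and \<open>A = UNIV\<close> gives \<open>X(\<omega>\<^sub>1)\<close>.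
  The thread \<open>emb \<gamma> x\<close> is the \<open>y\<close> with \<open>y\<^sub>\<gamma> = x\<close> and \<open>y\<^sub>\<beta> = y\<^sub>\<gamma>\<close> (modulo \<open>X(\<gamma>) \<subseteq> X(\<beta>)\<close>) for all
  \<open>\<beta> \<ge> \<gamma>\<close>; its coordinates below \<open>\<gamma>\<close> are then forced to be \<open>f\<^sup>\<gamma>\<^sub>\<beta> x\<close>.
\<close>

definition limit_stage :: "omega1 set \<Rightarrow> (omega1 \<Rightarrow> stage) \<Rightarrow> stage" where
  "limit_stage A F =
     \<lparr>space_of =
        quot_topology
          (subtopology (product_topology (\<lambda>\<beta>. space_of (F \<beta>)) A)
             {x. \<forall>\<beta>\<in>A. \<forall>\<gamma>\<le>\<beta>. bond (F \<beta>) \<gamma> (x \<beta>) = x \<gamma>})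
          Thread,
      a_of = Thread (\<lambda>\<beta>\<in>A. a_of (F \<beta>)),
      q_of = (\<lambda>n. Thread (\<lambda>\<beta>\<in>A. q_of (F \<beta>) n)),
      bond = (\<lambda>\<gamma>. if \<gamma> \<in> A then (\<lambda>p. coord p \<gamma>) else id),
      emb = (\<lambda>\<gamma>. if \<gamma> \<in> A
                  then (\<lambda>x. Thread (\<lambda>\<beta>\<in>A. if \<gamma> \<le> \<beta> then emb (F \<beta>) \<gamma> x else bond (F \<gamma>) \<beta> x))
                  else id)\<rparr>"

lemma product_topology_cong_on:
  assumes "\<And>i. i \<in> I \<Longrightarrow> S i = T i"
  shows "product_topology S I = product_topology T I"
proof -
  have *: "openin (product_topology T I) U" if "openin (product_topology S I) U"
    and "\<And>i. i \<in> I \<Longrightarrow> S i = T i" for S T :: "'a \<Rightarrow> 'b topology" and U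
    unfolding openin_product_topology_alt
  proof
    fix x assume "x \<in> U"
    then have "\<exists>V. finite {i \<in> I. V i \<noteq> topspace (S i)} \<and> (\<forall>i\<in>I. openin (S i) (V i)) \<and>
        x \<in> Pi\<^sub>E I V \<and> Pi\<^sub>E I V \<subseteq> U"
      using that(1) unfolding openin_product_topology_alt by (rule bspec[rotated])
    moreover have "{i \<in> I. V i \<noteq> topspace (T i)} = {i \<in> I. V i \<noteq> topspace (S i)}" for V
      using that(2) by auto
    ultimately show "\<exists>V. finite {i \<in> I. V i \<noteq> topspace (T i)} \<and> (\<forall>i\<in>I. openin (T i) (V i)) \<and>
        x \<in> Pi\<^sub>E I V \<and> Pi\<^sub>E I V \<subseteq> U"
      using that(2) by simp
  qed
  show ?thesis
    unfolding topology_eq using *[where S = S and T = T] *[where S = T and T = S] assms by metis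
qed

lemma limit_stage_cong [fundef_cong]:
  assumes "A = B" "\<And>\<beta>. \<beta> \<in> B \<Longrightarrow> F \<beta> = G \<beta>"
  shows "limit_stage A F = limit_stage B G"
proof -
  have "product_topology (\<lambda>\<beta>. space_of (F \<beta>)) B = product_topology (\<lambda>\<beta>. space_of (G \<beta>)) B"
    by (rule product_topology_cong_on) (simp add: assms(2))
  moreover have "(\<lambda>\<beta>\<in>B. if \<gamma> \<le> \<beta> then emb (F \<beta>) \<gamma> x else bond (F \<gamma>) \<beta> x)
      = (\<lambda>\<beta>\<in>B. if \<gamma> \<le> \<beta> then emb (G \<beta>) \<gamma> x else bond (G \<gamma>) \<beta> x)" if "\<gamma> \<in> B" for \<gamma> x
    using assms(2) that by (auto simp: restrict_def)
  moreover have "(\<lambda>\<beta>\<in>B. a_of (F \<beta>)) = (\<lambda>\<beta>\<in>B. a_of (G \<beta>))"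
    "(\<lambda>\<beta>\<in>B. q_of (F \<beta>) n) = (\<lambda>\<beta>\<in>B. q_of (G \<beta>) n)" for n
    using assms(2) by (auto simp: restrict_def)
  ultimately show ?thesis
    using assms by (simp add: limit_stage_def cong: if_cong)
qed

definition is_succ_of :: "omega1 \<Rightarrow> omega1 \<Rightarrow> bool" where
  "is_succ_of \<alpha> \<beta> \<longleftrightarrow> \<beta> < \<alpha> \<and> (\<forall>\<gamma><\<alpha>. \<gamma> \<le> \<beta>)"

lemma is_succ_of_unique: "is_succ_of \<alpha> \<beta> \<Longrightarrow> is_succ_of \<alpha> \<gamma> \<Longrightarrow> \<gamma> = \<beta>"
  unfolding is_succ_of_def by (meson order_antisym)

lemma is_succ_of_The: "is_succ_of \<alpha> \<beta> \<Longrightarrow> (THE \<beta>. is_succ_of \<alpha> \<beta>) = \<beta>"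
  by (blast intro: the_equality is_succ_of_unique)

lemma is_succ_of_The_less: "is_succ_of \<alpha> \<beta> \<Longrightarrow> (THE \<beta>. is_succ_of \<alpha> \<beta>) < \<alpha>"
  by (simp add: is_succ_of_The) (simp add: is_succ_of_def)

function X_stage :: "(nat \<Rightarrow> real \<times> real) \<Rightarrow> omega1 \<Rightarrow> stage" where
  "X_stage q0 \<alpha> =
     (if \<forall>\<gamma>. \<alpha> \<le> \<gamma> then zero_stage q0
      else if \<exists>\<beta>. is_succ_of \<alpha> \<beta>
        then succ_stage (THE \<beta>. is_succ_of \<alpha> \<beta>) (X_stage q0 (THE \<beta>. is_succ_of \<alpha> \<beta>))
      else limit_stage {..<\<alpha>} (X_stage q0))"
  by pat_completeness auto
termination
proof (relation "{((q, \<beta>), (q', \<alpha>)). \<beta> < \<alpha>}")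
  show "wf {((q :: nat \<Rightarrow> real \<times> real, \<beta>), (q' :: nat \<Rightarrow> real \<times> real, \<alpha> :: omega1)). \<beta> < \<alpha>}"
    by (rule wf_subset[OF wf_inv_image[OF wf, of snd]]) (auto simp: inv_image_def)
qed (auto dest: is_succ_of_The_less)

declare X_stage.simps [simp del]

definition X_omega1 :: "(nat \<Rightarrow> real \<times> real) \<Rightarrow> stage" where
  "X_omega1 q0 = limit_stage UNIV (X_stage q0)"

text \<open>The trivial composant \<open>E\<close>: the union of the copies of the \<open>X(\<alpha>)\<close>, \<open>\<alpha> < \<omega>\<^sub>1\<close>, in \<open>X(\<omega>\<^sub>1)\<close>.\<close>

definition trivial_composant :: "(nat \<Rightarrow> real \<times> real) \<Rightarrow> pt set" where
  "trivial_composant q0 =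
     (\<Union>\<alpha>. emb (X_omega1 q0) \<alpha> ` topspace (space_of (X_stage q0 \<alpha>)))"

end

theory Submission
  imports Defs
begin

text \<open>
  The trivial composant \<open>E\<close> is the union of the images \<open>K(\<alpha>)\<close> of the \<open>X(\<alpha>)\<close> in \<open>X(\<omega>\<^sub>1)\<close>. These
  are compact and increase with \<open>\<alpha>\<close>, and since countable sets of countable ordinals are bounded,
  every countable subset of \<open>E\<close> lies in a single \<open>K(\<alpha>)\<close>. If \<open>E\<close> were metrizable, it would thus be
  compact, because every infinite subset would have a limit point, and hence separable; a countable
  dense set lies in some closed \<open>K(\<beta>)\<close>, so that \<open>E = K(\<beta>)\<close> (\<open>metrizable_compact_exhaustion\<close>).
  But \<open>X(\<beta> + 1)\<close> contains the class of \<open>(a\<^sub>\<beta>, 1)\<close>, which is not glued to any point of the bottom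
  copy \<open>X(\<beta>) \<times> {0}\<close> (\<open>glue_zero\<close>), and therefore \<open>K(\<beta> + 1)\<close> is strictly larger than \<open>K(\<beta>)\<close>.

  The work lies in showing that the \<open>X(\<alpha>)\<close> are compact and that their embeddings are continuous and
  compatible. This is a transfinite induction (\<open>coherent_X_stage\<close>) for the predicate \<open>coherent\<close>, which
  strengthens it by what the induction consumes. Hausdorffness makes the intervals
  \<open>[a\<^sub>\<beta>, q\<^sup>n\<^sub>\<beta>]\<close> closed, hence the carrier \<open>N\<close> of a successor stage compact, and makes inverse limits
  closed in the product. It passes to the quotient \<open>X(\<beta> + 1)\<close> of \<open>N\<close> as long as
  \<open>a\<^sub>\<beta> \<noteq> q\<^sup>n\<^sub>\<beta>\<close> (\<open>Hausdorff_succ\<close>), which is why this inequality is part of the induction.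
\<close>

section \<open>Metrizable spaces exhausted by compact sets\<close>

lemma (in Metric_space) compact_imp_separable:
  assumes "compact_space mtopology"
  obtains D where "countable D" "D \<subseteq> M" "mtopology closure_of D = M"
proof -
  have "mtotally_bounded M"
    using assms compact_space_eq_mcomplete_mtotally_bounded by blast
  then have "\<forall>n. \<exists>K. finite K \<and> K \<subseteq> M \<and> M \<subseteq> (\<Union>x\<in>K. mball x (1 / Suc n))"
    unfolding mtotally_bounded_def by simp
  then obtain K where K: "\<And>n. finite (K n)" "\<And>n. K n \<subseteq> M"
      "\<And>n. M \<subseteq> (\<Union>x\<in>K n. mball x (1 / Suc n))"
    by metis
  have "M \<subseteq> mtopology closure_of (\<Union>n. K n)"
  proof
    fix y assume "y \<in> M"
    have "\<exists>x\<in>\<Union>n. K n. x \<in> mball y r" if "r > 0" for r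
    proof -
      obtain n where "1 / Suc n < r"
        using \<open>r > 0\<close> nat_approx_posE by blast
      moreover obtain x where "x \<in> K n" "y \<in> mball x (1 / Suc n)"
        using K(3)[of n] \<open>y \<in> M\<close> by blast
      ultimately show ?thesis
        by (force simp: commute)
    qed
    then show "y \<in> mtopology closure_of (\<Union>n. K n)"
      using \<open>y \<in> M\<close> by (auto simp: metric_closure_of)
  qed
  then have "mtopology closure_of (\<Union>n. K n) = M"
    using closure_of_subset_topspace[of mtopology "\<Union>n. K n"] by simp
  moreover have "countable (\<Union>n. K n)"
    using K(1) by (simp add: countable_finite)
  ultimately show ?thesis
    using K(2) that[of "\<Union>n. K n"] by blast
qed

text \<open>
  An infinite set contains a countable infinite one, which has a limit point because it lies in a
  compact member of \<open>\<K>\<close>; so the space is compact by Bolzano--Weierstrass, and separable.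
\<close>

lemma metrizable_compact_exhaustion:
  assumes X: "metrizable_space X"
    and compact: "\<And>K. K \<in> \<K> \<Longrightarrow> compactin X K"
    and countable: "\<And>C. countable C \<Longrightarrow> C \<subseteq> topspace X \<Longrightarrow> \<exists>K\<in>\<K>. C \<subseteq> K"
  shows "topspace X \<in> \<K>"
proof -
  obtain M d where M: "Metric_space M d" and Xd: "X = Metric_space.mtopology M d"
    using X unfolding metrizable_space_def by blast
  interpret Metric_space M d by (rule M)
  have "mtopology derived_set_of S \<noteq> {}" if "S \<subseteq> M" "infinite S" for S
  proof -
    obtain C where C: "countable C" "infinite C" "C \<subseteq> S"
      using infinite_countable_subset'[OF \<open>infinite S\<close>] by blast
    have "C \<subseteq> topspace X"
      using C(3) that(1) by (simp add: Xd)
    then obtain K where "K \<in> \<K>" "C \<subseteq> K"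
      using countable[OF C(1)] by blast
    then have "X derived_set_of C \<noteq> {}"
      using compactin_imp_Bolzano_Weierstrass[OF compact] C(2) by blast
    then show ?thesis
      using derived_set_of_mono[OF \<open>C \<subseteq> S\<close>] by (force simp: Xd)
  qed
  then have "compact_space mtopology"
    by (simp add: compact_space_eq_Bolzano_Weierstrass)
  \<comment> \<open>Separability moves the covering property from countable sets to the whole space.\<close>
  then obtain D where D: "countable D" "D \<subseteq> M" "mtopology closure_of D = M"
    by (rule compact_imp_separable)
  then obtain K where K: "K \<in> \<K>" "D \<subseteq> K"
    using countable[OF D(1)] by (auto simp: Xd)
  have "closedin mtopology K"
    using compactin_imp_closedin[OF Hausdorff_space_mtopology] compact[OF K(1)] by (simp add: Xd)
  then have "K = topspace X"
    using closure_of_minimal[OF K(2), of mtopology] D(3) closedin_subset[of mtopology K] Xd by auto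
  then show ?thesis
    using K(1) by simp
qed

section \<open>Quotient topologies\<close>

lemma quot_topology_homeomorphic:
  assumes "inj_on p (topspace T)"
  shows "T homeomorphic_space quot_topology T p"
  using assms quotient_map_quot_topology[of T p] homeomorphic_map_def homeomorphic_map_imp_homeomorphic_space
  by blast

lemma topspace_quot_topology [simp]: "topspace (quot_topology T p) = p ` topspace T"
  using quotient_imp_surjective_map[OF quotient_map_quot_topology] by metis

lemma continuous_map_quot: "continuous_map T (quot_topology T p) p"
  by (rule quotient_imp_continuous_map[OF quotient_map_quot_topology])

lemma continuous_map_from_quot:
  "continuous_map (quot_topology T p) Y g \<longleftrightarrow> continuous_map T Y (g \<circ> p)"
  using continuous_compose_quotient_map_eq[OF quotient_map_quot_topology] by blast

lemma compact_space_quot: "compact_space T \<Longrightarrow> compact_space (quot_topology T p)"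
  using image_compactin[OF _ continuous_map_quot, of T "topspace T" p] by (simp add: compact_space_def)

section \<open>The sine continuum\<close>

text \<open>
  Multiplying \<open>y = sin (1 / x)\<close> by \<open>x\<close> makes both sides continuous on the whole plane and the equation
  vacuous on the axis \<open>x = 0\<close>, which is exactly where the limit segment lives.
\<close>

lemma compact_sin_continuum: "compact sin_continuum"
proof -
  define g :: "real \<times> real \<Rightarrow> real" where "g = (\<lambda>(x, y). x * y - x * sin (1 / x))"
  have "isCont (\<lambda>x. x * sin (1 / x)) x" for x :: real
  proof (cases "x = 0")
    case True
    have "((\<lambda>x::real. x * sin (1 / x)) \<longlongrightarrow> 0) (at 0)"
      by (rule Lim_null_comparison[where g = "\<lambda>x. \<bar>x\<bar>"])
         (auto simp: abs_mult mult_left_le intro!: always_eventually tendsto_eq_intros)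
    then show ?thesis
      by (simp add: True isCont_def)
  qed (auto intro!: continuous_intros)
  then have "continuous_on UNIV (\<lambda>x :: real. x * sin (1 / x))"
    by (simp add: continuous_at_imp_continuous_on)
  then have "continuous_on UNIV (\<lambda>p :: real \<times> real. fst p * sin (1 / fst p))"
    using continuous_on_compose2[OF _ continuous_on_fst[OF continuous_on_id], of UNIV _ UNIV]
    by blast
  moreover have "continuous_on UNIV (\<lambda>p :: real \<times> real. fst p * snd p)"
    by (intro continuous_intros)
  ultimately have "continuous_on UNIV g"
    unfolding g_def case_prod_beta by (rule continuous_on_diff[rotated])
  then have "closed (g -` {0})"
    by (intro closed_vimage) auto
  moreover have "sin_continuum = ({- 2 / pi..0} \<times> {-1..1}) \<inter> g -` {0}"
  proof
    show "sin_continuum \<subseteq> ({- 2 / pi..0} \<times> {-1..1}) \<inter> g -` {0}"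
      by (auto simp: sin_continuum_def g_def)
    show "({- 2 / pi..0} \<times> {-1..1}) \<inter> g -` {0} \<subseteq> sin_continuum"
    proof
      fix p assume p: "p \<in> ({- 2 / pi..0} \<times> {-1..1}) \<inter> g -` {0}"
      obtain x y where [simp]: "p = (x, y)" by fastforce
      show "p \<in> sin_continuum"
      proof (cases "x = 0")
        case False
        then have "y = sin (1 / x)"
          using p by (auto simp: g_def)
        then show ?thesis
          using p False by (auto simp: sin_continuum_def)
      qed (use p in \<open>auto simp: sin_continuum_def\<close>)
    qed
  qed
  ultimately show ?thesis
    by (metis compact_Int_closed compact_Times compact_Icc)
qed

section \<open>Successor stages\<close>

text \<open>
  The two families of identifications are one zigzag: enumerated by \<open>m \<ge> 1\<close>, the sheets at the
  heights \<open>1 / m\<close> and \<open>1 / (m + 1)\<close> are glued in the single point with foot \<open>joint s m\<close>.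
\<close>

definition joint :: "stage \<Rightarrow> nat \<Rightarrow> pt" where
  "joint s m = (if odd m then q_of s ((m + 1) div 2) else a_of s)"

lemma glue_gen_joint:
  "glue_gen s = {((joint s m, 1 / real m), (joint s m, 1 / real (m + 1))) | m. m \<ge> 1}"
    (is "_ = ?R")
proof
  have "((q_of s n, 1 / (2 * real n - 1)), (q_of s n, 1 / (2 * real n))) \<in> ?R" if "n \<ge> 1" for n
    using that by (intro CollectI exI[of _ "2 * n - 1"]) (auto simp: joint_def of_nat_diff)
  moreover have "((a_of s, 1 / (2 * real n)), (a_of s, 1 / (2 * real n + 1))) \<in> ?R" if "n \<ge> 1" for n
    using that by (intro CollectI exI[of _ "2 * n"]) (auto simp: joint_def)
  ultimately show "glue_gen s \<subseteq> ?R"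
    unfolding glue_gen_def by blast
  show "?R \<subseteq> glue_gen s"
  proof clarify
    fix m :: nat assume "m \<ge> 1"
    show "((joint s m, 1 / real m), (joint s m, 1 / real (m + 1))) \<in> glue_gen s"
    proof (cases "odd m")
      case True
      then obtain k where "m = 2 * k + 1" by (auto elim: oddE)
      then show ?thesis
        unfolding glue_gen_def by (auto simp: joint_def intro!: exI[of _ "k + 1"])
    next
      case False
      then obtain k where "m = 2 * k" by (auto elim: evenE)
      then show ?thesis
        using \<open>m \<ge> 1\<close> unfolding glue_gen_def by (auto simp: joint_def intro!: exI[of _ k])
    qed
  qed
qed

definition sheet :: "stage \<Rightarrow> nat \<Rightarrow> pt set" where
  "sheet s m = continuum_interval (space_of s) (a_of s) (q_of s ((m + 1) div 2))"

lemma succ_carrier_sheets: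
  "succ_carrier s = (\<Union>m\<in>{1..}. sheet s m \<times> {1 / real m}) \<union> topspace (space_of s) \<times> {0}"
proof -
  let ?I = "\<lambda>n. continuum_interval (space_of s) (a_of s) (q_of s n)"
  have "(\<Union>n\<in>{1..}. ?I n \<times> {1 / (2 * real n - 1), 1 / (2 * real n)})
      = (\<Union>m\<in>{1..}. sheet s m \<times> {1 / real m})" (is "?L = ?R")
  proof
    show "?L \<subseteq> ?R"
    proof (rule subsetI, elim UN_E SigmaE; simp only:)
      fix n :: nat and x t
      assume n: "n \<in> {1..}" "x \<in> ?I n" and t: "t \<in> {1 / (2 * real n - 1), 1 / (2 * real n)}"
      have "x \<in> sheet s (2 * n - 1)" "x \<in> sheet s (2 * n)"
        using n by (auto simp: sheet_def)
      moreover have "t = 1 / real (2 * n - 1) \<or> t = 1 / real (2 * n)" "2 * n - 1 \<ge> 1" "2 * n \<ge> 1"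
        using t n by (auto simp: of_nat_diff)
      ultimately show "(x, t) \<in> ?R"
        by blast
    qed
    show "?R \<subseteq> ?L"
    proof (rule subsetI, elim UN_E SigmaE singletonE; simp only:)
      fix m :: nat and x
      assume m: "m \<in> {1..}" "x \<in> sheet s m"
      have "(m + 1) div 2 \<ge> 1" "1 / real m \<in> {1 / (2 * real ((m + 1) div 2) - 1), 1 / (2 * real ((m + 1) div 2))}"
        using m by (cases "odd m"; auto elim!: oddE evenE)+
      then show "(x, 1 / real m) \<in> ?L"
        using m unfolding sheet_def by blast
    qed
  qed
  then show ?thesis
    by (simp add: succ_carrier_def)
qed

lemma closedin_continuum_interval:
  assumes "Hausdorff_space T"
  shows "closedin T (continuum_interval T a b)"
proof -
  have "continuum_interval T a b = \<Inter>(insert (topspace T) {K. subcontinuum T K \<and> {a, b} \<subseteq> K})"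
    by (auto simp: continuum_interval_def)
  moreover have "closedin T K" if "subcontinuum T K" for K
    using that assms by (auto simp: subcontinuum_def continuum_def compactin_subspace intro!: compactin_imp_closedin)
  ultimately show ?thesis
    by (metis (mono_tags, lifting) closedin_Inter closedin_topspace insertE insert_not_empty mem_Collect_eq)
qed

definition succ_sum :: "stage \<Rightarrow> (pt \<times> real) topology" where
  "succ_sum s = subtopology (prod_topology (space_of s) (top_of_set {0..1})) (succ_carrier s)"

lemma succ_carrier_subset: "succ_carrier s \<subseteq> topspace (space_of s) \<times> {0..1}"
  by (auto simp: succ_carrier_sheets sheet_def continuum_interval_def divide_simps)

lemma topspace_succ_sum [simp]: "topspace (succ_sum s) = succ_carrier s"
  using succ_carrier_subset[of s] by (auto simp: succ_sum_def)

text \<open>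
  The sheets accumulate only at the bottom, so the carrier is the intersection over \<open>m\<close> of the closed
  sets consisting of its first \<open>m\<close> sheets and the slab of everything below height \<open>1 / m\<close>.
\<close>

lemma closedin_succ_carrier:
  assumes "Hausdorff_space (space_of s)"
  shows "closedin (prod_topology (space_of s) (top_of_set {0..1})) (succ_carrier s)"
proof -
  let ?P = "prod_topology (space_of s) (top_of_set {0..1::real})"
  define C where "C = (\<lambda>m::nat. topspace (space_of s) \<times> {0..1 / m}
      \<union> (\<Union>k\<in>{1..m}. sheet s k \<times> {1 / real k}))"
  have closed01: "closedin (top_of_set {0..1}) S" if "closed S" "S \<subseteq> {0..1::real}" for S
    using that by (simp add: closed_subset)
  have "closedin ?P (C m)" if "m \<ge> 1" for m
  proof -
    have "{0..1 / real m} \<subseteq> {0..1}"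
      using that by (auto simp: field_simps)
    then have "closedin ?P (topspace (space_of s) \<times> {0..1 / m})"
      by (simp add: closedin_prod_Times_iff closed01)
    moreover have "closedin ?P (sheet s k \<times> {1 / real k})" if "k \<in> {1..m}" for k
      using that
      by (simp add: closedin_prod_Times_iff sheet_def closedin_continuum_interval assms closed01)
    ultimately show ?thesis
      unfolding C_def by (intro closedin_Un closedin_Union finite_imageI) auto
  qed
  then have "closedin ?P (\<Inter>m\<in>{1..}. C m)"
    by (intro closedin_Inter) auto
  moreover have "succ_carrier s = (\<Inter>m\<in>{1..}. C m)"
  proof
    show "succ_carrier s \<subseteq> (\<Inter>m\<in>{1..}. C m)"
    proof (intro INT_greatest subsetI)
      fix m :: nat and p assume "m \<in> {1..}" and p: "p \<in> succ_carrier s"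
      obtain x t where [simp]: "p = (x, t)" by fastforce
      have x: "x \<in> topspace (space_of s)"
        using p succ_carrier_subset[of s] by auto
      consider "t = 0" | k where "k \<ge> 1" "t = 1 / real k" "x \<in> sheet s k"
        using p by (auto simp: succ_carrier_sheets)
      then show "p \<in> C m"
      proof cases
        case 1
        then show ?thesis using x by (simp add: C_def)
      next
        case 2
        show ?thesis
        proof (cases "k \<le> m")
          case False
          then have "t \<le> 1 / m"
            using \<open>m \<in> {1..}\<close> 2 by (auto simp: frac_le)
          then show ?thesis using x 2 by (simp add: C_def)
        qed (use 2 in \<open>auto simp: C_def\<close>)
      qed
    qed
    show "(\<Inter>m\<in>{1..}. C m) \<subseteq> succ_carrier s"
    proof
      fix p assume p: "p \<in> (\<Inter>m\<in>{1..}. C m)"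
      obtain x t where [simp]: "p = (x, t)" by fastforce
      have "p \<in> C 1"
        using p by auto
      then have t: "t \<ge> 0" "x \<in> topspace (space_of s)"
        by (auto simp: C_def sheet_def continuum_interval_def)
      show "p \<in> succ_carrier s"
      proof (cases "t = 0")
        case False
        then obtain n where "1 / real (Suc n) < t"
          using t nat_approx_posE[of t] by auto
        moreover have "p \<in> C (Suc n)"
          using p by auto
        ultimately show ?thesis
          by (auto simp: C_def succ_carrier_sheets)
      qed (use t in \<open>auto simp: succ_carrier_sheets\<close>)
    qed
  qed
  ultimately show ?thesis
    by simp
qed

lemma glue_joint:
  assumes "m \<ge> 1"
  shows "((joint s m, 1 / real m), (joint s m, 1 / real (m + 1))) \<in> glue s"
  using assms unfolding glue_def glue_gen_joint by blast

lemma foot_cls [simp]: "foot (cls s p) = fst p"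
  by (simp add: cls_def)

lemma cls_eqD: "cls s p = cls s p' \<Longrightarrow> fst p = fst p'"
  by (metis foot_cls)

lemma glue_zero: "(p, p') \<in> glue s \<Longrightarrow> snd p' = 0 \<longleftrightarrow> snd p = 0"
  unfolding glue_def by (induction rule: rtrancl_induct) (auto simp: glue_gen_joint)

text \<open>
  A height strictly between the sheets \<open>m\<close> and \<open>m + 1\<close>. Away from the foot \<open>joint s m\<close>, the parts of
  the carrier above and below this height are unions of classes (\<open>glue_gap\<close>); this is what separates
  two classes over the same foot.
\<close>

definition gap :: "nat \<Rightarrow> real" where
  "gap m = 1 / (real m + 1 / 2)"

lemma gap_less_iff: "k \<ge> 1 \<Longrightarrow> gap m < 1 / real k \<longleftrightarrow> k \<le> m"
  unfolding gap_def by (auto simp: divide_simps)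

lemma less_gap_iff: "k \<ge> 1 \<Longrightarrow> 1 / real k < gap m \<longleftrightarrow> m < k"
  unfolding gap_def by (auto simp: divide_simps)

lemma glue_gap:
  assumes "(p, p') \<in> glue s" "fst p \<noteq> joint s m"
  shows "(snd p < gap m \<longleftrightarrow> snd p' < gap m) \<and> (gap m < snd p \<longleftrightarrow> gap m < snd p')"
  using assms(1) unfolding glue_def
proof (induction rule: rtrancl_induct)
  case (step y z)
  have "fst y \<noteq> joint s m"
    using glue_fst[of p y s] step(1) assms(2) by (simp add: glue_def)
  moreover obtain k where "k \<ge> 1"
      "{y, z} = {(joint s k, 1 / real k), (joint s k, 1 / real (k + 1))}"
    using step(2) by (auto simp: glue_gen_joint)
  ultimately have "(snd y < gap m \<longleftrightarrow> snd z < gap m) \<and> (gap m < snd y \<longleftrightarrow> gap m < snd z)"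
    using gap_less_iff[of k m] gap_less_iff[of "k + 1" m] less_gap_iff[of k m] less_gap_iff[of "k + 1" m]
    by (cases "k = m") (auto simp: doubleton_eq_iff)
  then show ?case
    using step.IH by blast
qed simp

text \<open>
  If every joint between the two heights had foot \<open>x\<close>, the two points would be glued along a chain of
  adjacent sheets. When the lower point is in the bottom copy there are infinitely many joints
  between them; two consecutive ones have feet \<open>a\<close> and some \<open>q\<^sup>n\<close>, which are not both \<open>x\<close>.
\<close>

lemma gap_exists:
  assumes aq: "\<And>n. n \<ge> 1 \<Longrightarrow> q_of s n \<noteq> a_of s"
    and carrier: "(x, t) \<in> succ_carrier s" "(x, t') \<in> succ_carrier s"
    and less: "t' < t" and nglue: "((x, t), (x, t')) \<notin> glue s"
  obtains m where "joint s m \<noteq> x" "t' < gap m" "gap m < t"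
proof -
  have "t' \<ge> 0"
    using carrier succ_carrier_subset[of s] by auto
  then obtain i where i: "i \<ge> 1" "t = 1 / real i"
    using carrier less by (auto simp: succ_carrier_sheets)
  consider "t' = 0" | j where "j \<ge> 1" "t' = 1 / real j"
    using carrier by (auto simp: succ_carrier_sheets)
  then show ?thesis
  proof cases
    case 1
    have "joint s (2 * i) \<noteq> joint s (2 * i + 1)"
      using aq[of "i + 1"] by (auto simp: joint_def)
    then obtain m where "joint s m \<noteq> x" "m \<ge> i"
      by (metis le_add1 mult_2 trans_le_add1)
    then show ?thesis
      using that 1 i by (auto simp: gap_less_iff) (simp add: gap_def)
  next
    case (2 j)
    have "i < j"
      using less i 2 by (auto simp: divide_simps split: if_splits)
    have "\<exists>m\<ge>i. m < j \<and> joint s m \<noteq> x"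
    proof (rule ccontr)
      assume "\<not> ?thesis"
      then have joint: "joint s m = x" if "i \<le> m" "m < j" for m
        using that by auto
      have "cls s (x, 1 / real i) = cls s (x, 1 / real j)"
        using \<open>i < j\<close>[THEN less_imp_le]
      proof (induction rule: dec_induct)
        case (step n)
        then show ?case
          using glue_joint[of n s] joint[of n] i by (simp add: cls_eq_iff[symmetric])
      qed simp
      then show False
        using nglue i 2 by (simp add: cls_eq_iff)
    qed
    then show ?thesis
      using that 2 i by (auto simp: gap_less_iff less_gap_iff)
  qed
qed

text \<open>
  This is openness before passing to the quotient; for \<open>j = joint s m\<close> and \<open>V\<close> one of the two sides of
  \<open>gap m\<close> the set is also saturated.
\<close>

lemma openin_succ_part:
  assumes "Hausdorff_space (space_of s)" "open V"
  shows "openin (succ_sum s) {p \<in> succ_carrier s. fst p \<noteq> j \<and> snd p \<in> V}"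
proof -
  have "topspace (space_of s) - {j} = topspace (space_of s) - (topspace (space_of s) \<inter> {j})"
    by blast
  moreover have "closedin (space_of s) (topspace (space_of s) \<inter> {j})"
    using assms(1) by (cases "j \<in> topspace (space_of s)") (auto intro: closedin_Hausdorff_singleton)
  ultimately have "openin (space_of s) (topspace (space_of s) - {j})"
    by auto
  moreover have "openin (top_of_set {0..1}) ({0..1} \<inter> V)"
    using assms(2) by blast
  ultimately have "openin (prod_topology (space_of s) (top_of_set {0..1}))
      ((topspace (space_of s) - {j}) \<times> ({0..1} \<inter> V))"
    by (simp add: openin_prod_Times_iff)
  then have "openin (succ_sum s) (succ_carrier s \<inter> ((topspace (space_of s) - {j}) \<times> ({0..1} \<inter> V)))"
    unfolding succ_sum_def by (simp add: openin_subtopology_Int2)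
  then show ?thesis
    by (rule back_subst) (use succ_carrier_subset[of s] in auto)
qed

lemma continuous_map_foot:
  "continuous_map (quot_topology (succ_sum s) (cls s)) (space_of s) foot"
  unfolding continuous_map_from_quot
  by (rule continuous_map_eq[of _ _ fst])
     (auto simp: succ_sum_def intro: continuous_map_fst continuous_map_from_subtopology)

text \<open>
  Classes over different feet are separated by pulling back open sets along \<open>foot\<close>, classes over
  the same foot by a gap whose joint is elsewhere.
\<close>

lemma Hausdorff_succ:
  assumes H: "Hausdorff_space (space_of s)" and aq: "\<And>n. n \<ge> 1 \<Longrightarrow> q_of s n \<noteq> a_of s"
  shows "Hausdorff_space (quot_topology (succ_sum s) (cls s))" (is "Hausdorff_space ?Q")
proof -
  have sep: "\<exists>U V. openin ?Q U \<and> openin ?Q V \<and> cls s (x, t) \<in> U \<and> cls s (x, t') \<in> V \<and> disjnt U V"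
    if carrier: "(x, t) \<in> succ_carrier s" "(x, t') \<in> succ_carrier s"
      and less: "t' < t" and ne: "cls s (x, t) \<noteq> cls s (x, t')" for x t t'
  proof -
    obtain m where m: "joint s m \<noteq> x" "t' < gap m" "gap m < t"
      using gap_exists[OF aq carrier less] ne by (auto simp: cls_eq_iff)
    let ?part = "\<lambda>V. {p \<in> succ_carrier s. fst p \<noteq> joint s m \<and> snd p \<in> V}"
    have op: "openin ?Q (cls s ` ?part V)" if "V = {gap m<..} \<or> V = {..<gap m}" for V
    proof -
      have "p \<in> ?part V" if "p \<in> succ_carrier s" "p' \<in> ?part V" "cls s p = cls s p'" for p p'
        using that \<open>V = _ \<or> _\<close> glue_gap[of p p' s m] cls_eqD[of s p p'] by (auto simp: cls_eq_iff)
      then have "{p \<in> topspace (succ_sum s). cls s p \<in> cls s ` ?part V} \<subseteq> ?part V"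
        by auto
      moreover have "openin (succ_sum s) (?part V)"
        using that by (intro openin_succ_part H) auto
      ultimately show ?thesis
        using quotient_map_quot_topology[of "succ_sum s" "cls s"]
        unfolding quotient_map_saturated_open by blast
    qed
    have "disjnt (cls s ` ?part {gap m<..}) (cls s ` ?part {..<gap m})"
      using glue_gap[of _ _ s m] by (fastforce simp: disjnt_iff cls_eq_iff)
    moreover have "cls s (x, t) \<in> cls s ` ?part {gap m<..}" "cls s (x, t') \<in> cls s ` ?part {..<gap m}"
      using m carrier by auto
    ultimately show ?thesis
      using op by blast
  qed
  show ?thesis
    unfolding Hausdorff_space_def
  proof (intro allI impI, elim conjE)
    fix c c' assume "c \<in> topspace ?Q" "c' \<in> topspace ?Q" and ne: "c \<noteq> c'"
    then obtain x t x' t' where p: "(x, t) \<in> succ_carrier s" "(x', t') \<in> succ_carrier s"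
        and c: "c = cls s (x, t)" "c' = cls s (x', t')"
      by auto
    show "\<exists>U V. openin ?Q U \<and> openin ?Q V \<and> c \<in> U \<and> c' \<in> V \<and> disjnt U V"
    proof (cases "x = x'")
      case True
      then have "t \<noteq> t'"
        using ne c by auto
      then show ?thesis
        using sep[of x t t'] sep[of x t' t] p c ne True by (metis disjnt_sym linorder_neqE)
    next
      case False
      moreover have "x \<in> topspace (space_of s)" "x' \<in> topspace (space_of s)"
        using p succ_carrier_subset[of s] by auto
      ultimately obtain U V where UV: "openin (space_of s) U" "openin (space_of s) V"
          "x \<in> U" "x' \<in> V" "disjnt U V"
        using H unfolding Hausdorff_space_def by meson
      let ?pre = "\<lambda>U. {z \<in> topspace ?Q. foot z \<in> U}"
      have "openin ?Q (?pre U)" "openin ?Q (?pre V)"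
        using openin_continuous_map_preimage[OF continuous_map_foot] UV by blast+
      moreover have "c \<in> ?pre U" "c' \<in> ?pre V" "disjnt (?pre U) (?pre V)"
        using UV p c by (auto simp: disjnt_iff)
      ultimately show ?thesis
        by blast
    qed
  qed
qed

section \<open>Coherent towers\<close>

text \<open>
  \<open>link F \<beta> \<gamma>\<close> is the canonical map from \<open>X(\<gamma>)\<close> to \<open>X(\<beta>)\<close>, in whichever direction. With it, the
  various compatibilities of bonding maps and embeddings become the one law \<open>link_link\<close>, and the
  embedding of \<open>X(\<gamma>)\<close> into an inverse limit is \<open>x \<mapsto> (link F \<beta> \<gamma> x)\<^sub>\<beta>\<close>.
\<close>

definition link :: "(omega1 \<Rightarrow> stage) \<Rightarrow> omega1 \<Rightarrow> omega1 \<Rightarrow> pt \<Rightarrow> pt" where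
  "link F \<beta> \<gamma> = (if \<gamma> \<le> \<beta> then emb (F \<beta>) \<gamma> else bond (F \<gamma>) \<beta>)"

abbreviation points :: "(omega1 \<Rightarrow> stage) \<Rightarrow> omega1 \<Rightarrow> pt set" where
  "points F \<alpha> \<equiv> topspace (space_of (F \<alpha>))"

text \<open>
  The induction hypothesis at stage \<open>\<alpha>\<close>. That the bonding maps respect the points \<open>a\<^sub>\<beta>\<close> is what puts
  \<open>a\<^sub>\<alpha>\<close> into the inverse limit at limit stages.
\<close>

definition coherent :: "(omega1 \<Rightarrow> stage) \<Rightarrow> omega1 \<Rightarrow> bool" where
  "coherent F \<alpha> \<longleftrightarrow>
     compact_space (space_of (F \<alpha>)) \<and> Hausdorff_space (space_of (F \<alpha>)) \<and>
     a_of (F \<alpha>) \<in> points F \<alpha> \<and> (\<forall>n\<ge>1. q_of (F \<alpha>) n \<noteq> a_of (F \<alpha>)) \<and>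
     (\<forall>\<beta>\<le>\<alpha>. bond (F \<alpha>) \<beta> (a_of (F \<alpha>)) = a_of (F \<beta>)) \<and>
     bond (F \<alpha>) \<alpha> = id \<and> emb (F \<alpha>) \<alpha> = id \<and>
     (\<forall>\<beta>\<le>\<alpha>. continuous_map (space_of (F \<alpha>)) (space_of (F \<beta>)) (bond (F \<alpha>) \<beta>) \<and>
        continuous_map (space_of (F \<beta>)) (space_of (F \<alpha>)) (emb (F \<alpha>) \<beta>)) \<and>
     (\<forall>\<beta>\<le>\<alpha>. \<forall>\<gamma>\<le>\<beta>. \<forall>x\<in>points F \<alpha>. bond (F \<beta>) \<gamma> (bond (F \<alpha>) \<beta> x) = bond (F \<alpha>) \<gamma> x) \<and>
     (\<forall>\<beta>\<le>\<alpha>. \<forall>\<gamma>\<le>\<beta>. \<forall>x\<in>points F \<gamma>. emb (F \<alpha>) \<beta> (emb (F \<beta>) \<gamma> x) = emb (F \<alpha>) \<gamma> x) \<and>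
     (\<forall>\<beta>\<le>\<alpha>. \<forall>\<gamma>\<le>\<alpha>. \<forall>x\<in>points F \<gamma>. bond (F \<alpha>) \<beta> (emb (F \<alpha>) \<gamma> x) = link F \<beta> \<gamma> x)"

lemma coherentD:
  assumes "coherent F \<alpha>"
  shows "compact_space (space_of (F \<alpha>))" "Hausdorff_space (space_of (F \<alpha>))"
    "a_of (F \<alpha>) \<in> points F \<alpha>" "\<And>n. n \<ge> 1 \<Longrightarrow> q_of (F \<alpha>) n \<noteq> a_of (F \<alpha>)"
    "bond (F \<alpha>) \<alpha> = id" "emb (F \<alpha>) \<alpha> = id"
    "\<And>\<beta>. \<beta> \<le> \<alpha> \<Longrightarrow> continuous_map (space_of (F \<alpha>)) (space_of (F \<beta>)) (bond (F \<alpha>) \<beta>)"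
    "\<And>\<beta>. \<beta> \<le> \<alpha> \<Longrightarrow> continuous_map (space_of (F \<beta>)) (space_of (F \<alpha>)) (emb (F \<alpha>) \<beta>)"
    "\<And>\<beta> \<gamma> x. \<beta> \<le> \<alpha> \<Longrightarrow> \<gamma> \<le> \<beta> \<Longrightarrow> x \<in> points F \<alpha> \<Longrightarrow>
       bond (F \<beta>) \<gamma> (bond (F \<alpha>) \<beta> x) = bond (F \<alpha>) \<gamma> x"
    "\<And>\<beta> \<gamma> x. \<beta> \<le> \<alpha> \<Longrightarrow> \<gamma> \<le> \<beta> \<Longrightarrow> x \<in> points F \<gamma> \<Longrightarrow>
       emb (F \<alpha>) \<beta> (emb (F \<beta>) \<gamma> x) = emb (F \<alpha>) \<gamma> x"
    "\<And>\<beta> \<gamma> x. \<beta> \<le> \<alpha> \<Longrightarrow> \<gamma> \<le> \<alpha> \<Longrightarrow> x \<in> points F \<gamma> \<Longrightarrow>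
       bond (F \<alpha>) \<beta> (emb (F \<alpha>) \<gamma> x) = link F \<beta> \<gamma> x"
    "\<And>\<beta>. \<beta> \<le> \<alpha> \<Longrightarrow> bond (F \<alpha>) \<beta> (a_of (F \<alpha>)) = a_of (F \<beta>)"
  using assms unfolding coherent_def by blast+

subsection \<open>Successors\<close>

lemma coherent_succ:
  assumes coh: "coherent F \<beta>" and F: "F \<alpha> = succ_stage \<beta> (F \<beta>)" and succ: "is_succ_of \<alpha> \<beta>"
  shows "coherent F \<alpha>"
proof -
  note c = coherentD[OF coh]
  let ?s = "F \<beta>"
  let ?Q = "quot_topology (succ_sum ?s) (cls ?s)"
  have le: "\<gamma> \<le> \<alpha> \<longleftrightarrow> \<gamma> = \<alpha> \<or> \<gamma> \<le> \<beta>" for \<gamma>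
    using succ unfolding is_succ_of_def by (metis order.strict_implies_order order.strict_trans1 order_le_less)
  have [simp]: "\<not> \<alpha> \<le> \<gamma>" if "\<gamma> \<le> \<beta>" for \<gamma>
    using succ that by (auto simp: is_succ_of_def not_le)
  have space: "space_of (F \<alpha>) = ?Q"
    by (simp add: F succ_stage_def succ_sum_def)
  have bond: "bond (F \<alpha>) \<gamma> = (if \<gamma> \<le> \<beta> then bond ?s \<gamma> \<circ> foot else id)" for \<gamma>
    by (simp add: F succ_stage_def)
  have emb: "emb (F \<alpha>) \<gamma> = (if \<gamma> \<le> \<beta> then (\<lambda>x. cls ?s (emb ?s \<gamma> x, 0)) else id)" for \<gamma>
    by (simp add: F succ_stage_def)
  have foot_in: "foot x \<in> points F \<beta>" if "x \<in> points F \<alpha>" for x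
    using continuous_map_funspace[OF continuous_map_foot[of ?s]] that by (auto simp: space)
  have base: "continuous_map (space_of ?s) ?Q (\<lambda>x. cls ?s (x, 0))"
  proof -
    have "continuous_map (space_of ?s) (succ_sum ?s) (\<lambda>x. (x, 0))"
      unfolding succ_sum_def
      by (auto simp: continuous_map_in_subtopology continuous_map_pairwise o_def succ_carrier_sheets
          intro!: continuous_map_const[THEN iffD2])
    from continuous_map_compose[OF this continuous_map_quot] show ?thesis
      by (simp add: o_def)
  qed
  have "compact_space (prod_topology (space_of ?s) (top_of_set {0..1::real}))"
    using c(1) by (simp add: compact_space_prod_topology compact_space_subtopology)
  then have "compact_space (succ_sum ?s)"
    unfolding succ_sum_def using closedin_succ_carrier[OF c(2)]
    by (simp add: closedin_compact_space compact_space_subtopology)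
  then have "compact_space ?Q"
    by (rule compact_space_quot)
  moreover have "Hausdorff_space ?Q"
    by (rule Hausdorff_succ[OF c(2,4)])
  moreover have "a_of (F \<alpha>) \<in> points F \<alpha>"
  proof -
    have "(a_of ?s, 1) \<in> succ_carrier ?s"
      using c(3) by (auto simp: succ_carrier_sheets sheet_def continuum_interval_def intro!: bexI[of _ 1])
    then show ?thesis
      by (auto simp: space F succ_stage_def succ_sum_def[symmetric])
  qed
  moreover have "q_of (F \<alpha>) n \<noteq> a_of (F \<alpha>)" if "n \<ge> 1" for n
    using c(4)[OF that] by (auto simp: F succ_stage_def dest: cls_eqD)
  moreover have "bond (F \<alpha>) \<gamma> (a_of (F \<alpha>)) = a_of (F \<gamma>)" if "\<gamma> \<le> \<alpha>" for \<gamma>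
  proof -
    have "foot (a_of (F \<alpha>)) = a_of ?s"
      by (simp add: F succ_stage_def)
    then show ?thesis
      using that c(12) by (auto simp: le bond)
  qed
  moreover have "continuous_map ?Q (space_of (F \<gamma>)) (bond (F \<alpha>) \<gamma>)"
      "continuous_map (space_of (F \<gamma>)) ?Q (emb (F \<alpha>) \<gamma>)" if "\<gamma> \<le> \<alpha>" for \<gamma>
    using that continuous_map_compose[OF continuous_map_foot c(7)]
      continuous_map_compose[OF c(8) base]
    by (auto simp: le bond emb o_def space id_def)
  moreover have "bond (F \<gamma>) \<delta> (bond (F \<alpha>) \<gamma> x) = bond (F \<alpha>) \<delta> x"
    if "\<gamma> \<le> \<alpha>" "\<delta> \<le> \<gamma>" "x \<in> points F \<alpha>" for \<gamma> \<delta> x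
    using that c(9)[of \<gamma> \<delta> "foot x"] foot_in[of x] by (auto simp: le bond)
  moreover have "emb (F \<alpha>) \<gamma> (emb (F \<gamma>) \<delta> x) = emb (F \<alpha>) \<delta> x"
    if "\<gamma> \<le> \<alpha>" "\<delta> \<le> \<gamma>" "x \<in> points F \<delta>" for \<gamma> \<delta> x
    using that c(10)[of \<gamma> \<delta> x] by (auto simp: le emb)
  moreover have "bond (F \<alpha>) \<gamma> (emb (F \<alpha>) \<delta> x) = link F \<gamma> \<delta> x"
    if "\<gamma> \<le> \<alpha>" "\<delta> \<le> \<alpha>" "x \<in> points F \<delta>" for \<gamma> \<delta> x
    using that c(11)[of \<gamma> \<delta> x] by (auto simp: le bond emb link_def)
  ultimately show ?thesis
    unfolding coherent_def space[symmetric] by (simp add: bond[of \<alpha>] emb[of \<alpha>])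
qed

subsection \<open>Limits\<close>

text \<open>
  Both the countable limit stages (\<open>A = {..<\<alpha>}\<close>) and \<open>X(\<omega>\<^sub>1)\<close> (\<open>A = UNIV\<close>) are instances.
\<close>

locale coherent_tower =
  fixes F :: "omega1 \<Rightarrow> stage" and A :: "omega1 set"
  assumes coherent: "\<alpha> \<in> A \<Longrightarrow> coherent F \<alpha>"
    and down: "\<alpha> \<in> A \<Longrightarrow> \<beta> \<le> \<alpha> \<Longrightarrow> \<beta> \<in> A"
    and nonempty: "A \<noteq> {}"
begin

lemma link_continuous:
  assumes "\<beta> \<in> A" "\<gamma> \<in> A"
  shows "continuous_map (space_of (F \<gamma>)) (space_of (F \<beta>)) (link F \<beta> \<gamma>)"
  using assms coherentD(7,8)[OF coherent] by (simp add: link_def)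

lemma link_in: "\<beta> \<in> A \<Longrightarrow> \<gamma> \<in> A \<Longrightarrow> x \<in> points F \<gamma> \<Longrightarrow> link F \<beta> \<gamma> x \<in> points F \<beta>"
  using continuous_map_funspace[OF link_continuous] by auto

text \<open>
  The side condition excludes passing through a stage below both ends, where the retraction loses
  information.
\<close>

lemma link_link:
  assumes "\<alpha> \<in> A" "\<beta> \<in> A" "\<gamma> \<in> A" "\<alpha> \<le> \<beta> \<or> \<gamma> \<le> \<beta>" "x \<in> points F \<gamma>"
  shows "link F \<alpha> \<beta> (link F \<beta> \<gamma> x) = link F \<alpha> \<gamma> x"
proof (cases "\<beta> \<le> \<alpha>")
  case True
  show ?thesis
  proof (cases "\<alpha> = \<beta>")
    case True
    then show ?thesis
      using coherentD(6)[OF coherent, of \<beta>] assms by (simp add: link_def)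
  next
    case False
    then have "\<gamma> \<le> \<beta>" "\<gamma> \<le> \<alpha>"
      using assms \<open>\<beta> \<le> \<alpha>\<close> by auto
    then show ?thesis
      using coherentD(10)[OF coherent, of \<alpha> \<beta> \<gamma> x] assms True by (simp add: link_def)
  qed
next
  case False
  then show ?thesis
    using coherentD(11)[OF coherent, of \<beta> \<alpha> \<gamma> x] coherentD(9)[OF coherent, of \<gamma> \<beta> \<alpha> x] assms
    by (cases "\<gamma> \<le> \<beta>") (auto simp: link_def)
qed

lemma bond_link:
  assumes "\<beta> \<in> A" "\<gamma> \<in> A" "\<alpha> \<le> \<beta>" "x \<in> points F \<gamma>"
  shows "bond (F \<beta>) \<alpha> (link F \<beta> \<gamma> x) = link F \<alpha> \<gamma> x"
proof (cases "\<alpha> = \<beta>")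
  case False
  then show ?thesis
    using link_link[of \<alpha> \<beta> \<gamma> x] assms down[of \<beta> \<alpha>] by (simp add: link_def)
qed (use coherentD(5)[OF coherent, of \<beta>] assms in simp)

definition threads :: "(omega1 \<Rightarrow> pt) topology" where
  "threads = subtopology (product_topology (\<lambda>\<beta>. space_of (F \<beta>)) A)
     {x. \<forall>\<beta>\<in>A. \<forall>\<gamma>\<le>\<beta>. bond (F \<beta>) \<gamma> (x \<beta>) = x \<gamma>}"

abbreviation limit :: stage where "limit \<equiv> limit_stage A F"

lemma space_limit: "space_of limit = quot_topology threads Thread"
  by (simp add: limit_stage_def threads_def)

lemma bond_limit: "bond limit \<gamma> = (if \<gamma> \<in> A then (\<lambda>p. coord p \<gamma>) else id)"
  by (simp add: limit_stage_def)

lemma emb_limit: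
  "emb limit \<gamma> = (if \<gamma> \<in> A then (\<lambda>x. Thread (\<lambda>\<beta>\<in>A. link F \<beta> \<gamma> x)) else id)"
proof -
  have "(if \<gamma> \<le> \<beta> then emb (F \<beta>) \<gamma> x else bond (F \<gamma>) \<beta> x) = link F \<beta> \<gamma> x" for \<beta> x
    by (simp add: link_def)
  then show ?thesis
    by (simp add: limit_stage_def)
qed

lemma limit_homeomorphic: "threads homeomorphic_space space_of limit"
  unfolding space_limit by (rule quot_topology_homeomorphic) (simp add: inj_on_def)

lemma coord_continuous:
  assumes "\<beta> \<in> A"
  shows "continuous_map (product_topology (\<lambda>\<beta>. space_of (F \<beta>)) A) (space_of (F \<beta>)) (\<lambda>x. x \<beta>)"
  using continuous_map_product_coordinates[OF assms] .

lemma limit_Hausdorff: "Hausdorff_space (space_of limit)"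
proof -
  have "Hausdorff_space threads"
    unfolding threads_def
    by (intro Hausdorff_space_subtopology)
       (simp add: Hausdorff_space_product_topology coherentD(2)[OF coherent])
  then show ?thesis
    using homeomorphic_Hausdorff_space[OF limit_homeomorphic] by blast
qed

lemma limit_compact: "compact_space (space_of limit)"
proof -
  let ?P = "product_topology (\<lambda>\<beta>. space_of (F \<beta>)) A"
  let ?E = "\<lambda>\<beta> \<gamma>. {x \<in> topspace ?P. bond (F \<beta>) \<gamma> (x \<beta>) = x \<gamma>}"
  have P: "compact_space ?P"
    by (simp add: compact_space_product_topology coherentD(1)[OF coherent])
  have closed: "closedin ?P (?E \<beta> \<gamma>)" if "\<beta> \<in> A" "\<gamma> \<le> \<beta>" for \<beta> \<gamma>
  proof (rule closedin_continuous_maps_eq)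
    show "Hausdorff_space (space_of (F \<gamma>))"
      by (rule coherentD(2)[OF coherent[OF down[OF that]]])
    show "continuous_map ?P (space_of (F \<gamma>)) (\<lambda>x. bond (F \<beta>) \<gamma> (x \<beta>))"
      using continuous_map_compose[OF coord_continuous[OF that(1)] coherentD(7)[OF coherent that(2)]] that
      by (simp add: o_def)
    show "continuous_map ?P (space_of (F \<gamma>)) (\<lambda>x. x \<gamma>)"
      by (rule coord_continuous[OF down[OF that]])
  qed
  have "closedin ?P (\<Inter>\<beta>\<in>A. \<Inter>\<gamma>\<in>{..\<beta>}. ?E \<beta> \<gamma>)"
    using nonempty closed by (intro closedin_INT) auto
  moreover have "topspace ?P \<inter> {x. \<forall>\<beta>\<in>A. \<forall>\<gamma>\<le>\<beta>. bond (F \<beta>) \<gamma> (x \<beta>) = x \<gamma>}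
      = (\<Inter>\<beta>\<in>A. \<Inter>\<gamma>\<in>{..\<beta>}. ?E \<beta> \<gamma>)"
    using nonempty by auto
  ultimately have "compactin ?P (topspace ?P \<inter> {x. \<forall>\<beta>\<in>A. \<forall>\<gamma>\<le>\<beta>. bond (F \<beta>) \<gamma> (x \<beta>) = x \<gamma>})"
    using closedin_compact_space[OF P] by simp
  then have "compact_space (subtopology ?P
      (topspace ?P \<inter> {x. \<forall>\<beta>\<in>A. \<forall>\<gamma>\<le>\<beta>. bond (F \<beta>) \<gamma> (x \<beta>) = x \<gamma>}))"
    by (rule compact_space_subtopology)
  then have "compact_space threads"
    by (simp only: threads_def subtopology_restrict)
  then show ?thesis
    unfolding space_limit by (rule compact_space_quot)
qed

lemma bond_limit_continuous:
  assumes "\<beta> \<in> A"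
  shows "continuous_map (space_of limit) (space_of (F \<beta>)) (bond limit \<beta>)"
  using assms
  by (simp add: space_limit continuous_map_from_quot bond_limit threads_def o_def
      continuous_map_from_subtopology coord_continuous)

lemma emb_limit_continuous:
  assumes "\<gamma> \<in> A"
  shows "continuous_map (space_of (F \<gamma>)) (space_of limit) (emb limit \<gamma>)"
proof -
  have "continuous_map (space_of (F \<gamma>)) (product_topology (\<lambda>\<beta>. space_of (F \<beta>)) A)
      (\<lambda>x. \<lambda>\<beta>\<in>A. link F \<beta> \<gamma> x)"
    using link_continuous assms by (intro continuous_map_coordinatewise_then_product) auto
  then have "continuous_map (space_of (F \<gamma>)) threads (\<lambda>x. \<lambda>\<beta>\<in>A. link F \<beta> \<gamma> x)"
    unfolding threads_def using assms down by (auto simp: continuous_map_in_subtopology bond_link)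
  from continuous_map_compose[OF this continuous_map_quot] show ?thesis
    using assms by (simp add: space_limit emb_limit o_def)
qed

text \<open>
  This makes the images of the \<open>X(\<alpha>)\<close> in the limit increase with \<open>\<alpha>\<close>.
\<close>

lemma emb_limit_emb:
  assumes "\<beta> \<in> A" "\<gamma> \<le> \<beta>" "x \<in> points F \<gamma>"
  shows "emb limit \<beta> (emb (F \<beta>) \<gamma> x) = emb limit \<gamma> x"
proof -
  have "link F \<delta> \<beta> (emb (F \<beta>) \<gamma> x) = link F \<delta> \<gamma> x" if "\<delta> \<in> A" for \<delta>
    using link_link[of \<delta> \<beta> \<gamma> x] assms that down[of \<beta> \<gamma>] by (simp add: link_def[of F \<beta> \<gamma>])
  then show ?thesis
    using assms down[of \<beta> \<gamma>] by (auto simp: emb_limit)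
qed

lemma bond_limit_emb:
  assumes "\<beta> \<in> A" "\<gamma> \<in> A"
  shows "bond limit \<beta> (emb limit \<gamma> x) = link F \<beta> \<gamma> x"
  using assms by (simp add: bond_limit emb_limit)

lemma bond_a_limit:
  assumes "\<beta> \<in> A"
  shows "bond limit \<beta> (a_of limit) = a_of (F \<beta>)"
  using assms unfolding bond_limit by (simp add: limit_stage_def)

lemma a_limit_in: "a_of limit \<in> topspace (space_of limit)"
proof -
  have "(\<lambda>\<beta>\<in>A. a_of (F \<beta>)) \<in> topspace threads"
    using coherentD(3)[OF coherent] coherentD(12)[OF coherent] down
    by (auto simp: threads_def)
  then show ?thesis
    unfolding space_limit by (simp add: limit_stage_def)
qed

lemma bond_bond_limit:
  assumes "\<beta> \<in> A" "\<gamma> \<le> \<beta>" "x \<in> topspace (space_of limit)"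
  shows "bond (F \<beta>) \<gamma> (bond limit \<beta> x) = bond limit \<gamma> x"
  using assms down[of \<beta> \<gamma>] by (auto simp: bond_limit space_limit threads_def)

end

lemma coherent_limit:
  assumes tower: "coherent_tower F {..<\<alpha>}" and F: "F \<alpha> = limit_stage {..<\<alpha>} F"
  shows "coherent F \<alpha>"
proof -
  interpret coherent_tower F "{..<\<alpha>}" by (rule tower)
  have le: "\<gamma> \<le> \<alpha> \<longleftrightarrow> \<gamma> = \<alpha> \<or> \<gamma> \<in> {..<\<alpha>}" for \<gamma>
    by auto
  have id: "bond (F \<alpha>) \<alpha> = id" "emb (F \<alpha>) \<alpha> = id"
    by (simp_all add: F bond_limit emb_limit)
  have "q_of (F \<alpha>) n \<noteq> a_of (F \<alpha>)" if "n \<ge> 1" for n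
  proof -
    obtain \<beta> where "\<beta> < \<alpha>"
      using nonempty by auto
    then have "q_of (F \<beta>) n \<noteq> a_of (F \<beta>)"
      using coherentD(4)[OF coherent that] by simp
    then show ?thesis
      using \<open>\<beta> < \<alpha>\<close> by (auto simp: F limit_stage_def fun_eq_iff restrict_def split: if_splits)
  qed
  moreover have "bond (F \<alpha>) \<beta> (a_of (F \<alpha>)) = a_of (F \<beta>)" if "\<beta> \<le> \<alpha>" for \<beta>
  proof (cases "\<beta> = \<alpha>")
    case False
    then show ?thesis
      using bond_a_limit[of \<beta>] that F by simp
  qed (simp add: id)
  moreover have "continuous_map (space_of (F \<alpha>)) (space_of (F \<beta>)) (bond (F \<alpha>) \<beta>)"
      "continuous_map (space_of (F \<beta>)) (space_of (F \<alpha>)) (emb (F \<alpha>) \<beta>)" if "\<beta> \<le> \<alpha>" for \<beta>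
    using that bond_limit_continuous[of \<beta>] emb_limit_continuous[of \<beta>] id
    by (auto simp: le F id_def)
  moreover have "bond (F \<beta>) \<gamma> (bond (F \<alpha>) \<beta> x) = bond (F \<alpha>) \<gamma> x"
    if "\<beta> \<le> \<alpha>" "\<gamma> \<le> \<beta>" "x \<in> points F \<alpha>" for \<beta> \<gamma> x
    using that id bond_bond_limit[of \<beta> \<gamma> x] by (cases "\<beta> = \<alpha>") (auto simp: F)
  moreover have "emb (F \<alpha>) \<beta> (emb (F \<beta>) \<gamma> x) = emb (F \<alpha>) \<gamma> x"
    if "\<beta> \<le> \<alpha>" "\<gamma> \<le> \<beta>" "x \<in> points F \<gamma>" for \<beta> \<gamma> x
    using that id emb_limit_emb[of \<beta> \<gamma> x] by (cases "\<beta> = \<alpha>") (auto simp: F)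
  moreover have "bond (F \<alpha>) \<beta> (emb (F \<alpha>) \<gamma> x) = link F \<beta> \<gamma> x"
    if "\<beta> \<le> \<alpha>" "\<gamma> \<le> \<alpha>" "x \<in> points F \<gamma>" for \<beta> \<gamma> x
  proof -
    consider "\<beta> = \<alpha>" | "\<gamma> = \<alpha>" "\<beta> < \<alpha>" | "\<beta> < \<alpha>" "\<gamma> < \<alpha>"
      using \<open>\<beta> \<le> \<alpha>\<close> \<open>\<gamma> \<le> \<alpha>\<close> by fastforce
    then show ?thesis
    proof cases
      case 3
      then show ?thesis
        using bond_limit_emb[of \<beta> \<gamma> x] F by simp
    qed (use id that in \<open>auto simp: link_def\<close>)
  qed
  ultimately show ?thesis
    unfolding coherent_def using limit_compact limit_Hausdorff a_limit_in id
    by (simp only: F[symmetric]) auto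
qed


section \<open>Coherence of the construction and the trivial composant\<close>

lemma coherent_zero:
  assumes F: "F \<alpha> = zero_stage q0" and zero: "\<And>\<gamma>. \<alpha> \<le> \<gamma>"
    and q: "\<And>n. n \<ge> 1 \<Longrightarrow> q0 n \<in> sin_graph"
  shows "coherent F \<alpha>"
proof -
  let ?T = "top_of_set sin_continuum"
  have "\<gamma> \<le> \<alpha> \<longleftrightarrow> \<gamma> = \<alpha>" for \<gamma>
    using zero[of \<gamma>] by auto
  moreover have hom: "?T homeomorphic_space quot_topology ?T Base"
    by (rule quot_topology_homeomorphic) (simp add: inj_on_def)
  have "compact_space (quot_topology ?T Base)"
    by (rule compact_space_quot)
       (simp add: compact_space_subtopology compactin_euclidean_iff compact_sin_continuum)
  moreover have "Hausdorff_space (quot_topology ?T Base)"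
    using hom by (metis homeomorphic_Hausdorff_space Hausdorff_space_euclidean Hausdorff_space_subtopology)
  moreover have "(- 2 / pi, -1) \<in> sin_continuum"
    by (auto simp: sin_continuum_def)
  moreover have "q0 n \<noteq> (- 2 / pi, -1)" if "n \<ge> 1" for n
    using q[OF that] by (auto simp: sin_graph_def)
  ultimately show ?thesis
    unfolding coherent_def by (simp add: F zero_stage_def link_def id_def)
qed

lemma X_stage_succ:
  assumes "is_succ_of \<alpha> \<beta>"
  shows "X_stage q0 \<alpha> = succ_stage \<beta> (X_stage q0 \<beta>)"
proof -
  have "\<not> (\<forall>\<gamma>. \<alpha> \<le> \<gamma>)" "\<exists>\<beta>. is_succ_of \<alpha> \<beta>"
    using assms by (auto simp: is_succ_of_def not_le)
  then show ?thesis
    by (subst X_stage.simps) (simp only: is_succ_of_The[OF assms] if_False if_True)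
qed

lemma X_stage_limit:
  assumes "\<not> (\<forall>\<gamma>. \<alpha> \<le> \<gamma>)" "\<nexists>\<beta>. is_succ_of \<alpha> \<beta>"
  shows "X_stage q0 \<alpha> = limit_stage {..<\<alpha>} (X_stage q0)"
  by (subst X_stage.simps) (simp only: assms if_False)

lemma coherent_X_stage:
  assumes q: "\<And>n. n \<ge> 1 \<Longrightarrow> q0 n \<in> sin_graph"
  shows "coherent (X_stage q0) \<alpha>"
proof (induction \<alpha> rule: less_induct)
  case (less \<alpha>)
  show ?case
  proof (cases "\<forall>\<gamma>. \<alpha> \<le> \<gamma>")
    case True
    then show ?thesis
      by (intro coherent_zero[OF _ _ q]) (auto simp: X_stage.simps[of q0 \<alpha>])
  next
    case nonzero: False
    show ?thesis
    proof (cases "\<exists>\<beta>. is_succ_of \<alpha> \<beta>")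
      case True
      then obtain \<beta> where \<beta>: "is_succ_of \<alpha> \<beta>"
        by blast
      then have "\<beta> < \<alpha>"
        by (simp add: is_succ_of_def)
      then show ?thesis
        using coherent_succ[OF less X_stage_succ[OF \<beta>] \<beta>] by blast
    next
      case False
      have "coherent_tower (X_stage q0) {..<\<alpha>}"
        using less nonzero by unfold_locales (auto simp: not_le)
      then show ?thesis
        using X_stage_limit[OF nonzero False] by (rule coherent_limit)
    qed
  qed
qed

lemma countable_atMost_omega1: "countable {..\<alpha> :: omega1}"
  using countable_lessThan_omega1[of \<alpha>] by (simp flip: ivl_disj_un_singleton(2))

lemma countable_bounded_omega1:
  fixes S :: "omega1 set"
  assumes "countable S"
  obtains \<beta> where "\<And>\<alpha>. \<alpha> \<in> S \<Longrightarrow> \<alpha> < \<beta>"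
proof -
  have "countable (\<Union>\<alpha>\<in>S. {..\<alpha>})"
    using assms countable_atMost_omega1 by blast
  then obtain \<beta> where "\<beta> \<notin> (\<Union>\<alpha>\<in>S. {..\<alpha>})"
    using uncountable_omega1 by (metis UNIV_eq_I)
  then show ?thesis
    using that[of \<beta>] by (auto simp: not_le)
qed

lemma succ_exists_omega1: obtains \<alpha> where "is_succ_of \<alpha> \<beta>"
proof -
  obtain \<delta> where "\<beta> < \<delta>"
    using countable_bounded_omega1[of "{\<beta>}"] by auto
  then have "is_succ_of (LEAST \<alpha>. \<beta> < \<alpha>) \<beta>"
    unfolding is_succ_of_def using not_less_Least by (auto intro: LeastI leI)
  then show ?thesis
    by (rule that)
qed

theorem claim18:
  fixes q0 :: "nat \<Rightarrow> real \<times> real"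
  assumes "\<And>n. n \<ge> 1 \<Longrightarrow> q0 n \<in> sin_graph"
    and "\<And>m n. 1 \<le> m \<Longrightarrow> m < n \<Longrightarrow> fst (q0 m) < fst (q0 n)"
    and "(\<lambda>n. fst (q0 n)) \<longlonglongrightarrow> 0"
  shows "\<not> metrizable_space
           (subtopology (space_of (X_omega1 q0)) (trivial_composant q0))"
proof
  let ?F = "X_stage q0"
  let ?X = "space_of (X_omega1 q0)"
  let ?E = "trivial_composant q0"
  define K where "K \<alpha> = emb (X_omega1 q0) \<alpha> ` points ?F \<alpha>" for \<alpha>
  note coherent = coherent_X_stage[of q0, OF assms(1)]
  interpret coherent_tower ?F UNIV
    using coherent by unfold_locales auto
  have E: "?E = (\<Union>\<alpha>. K \<alpha>)"
    by (simp add: trivial_composant_def K_def)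
  have K_compact: "compactin ?X (K \<alpha>)" for \<alpha>
    unfolding K_def X_omega1_def using coherentD(1)[OF coherent] emb_limit_continuous
    by (intro image_compactin) (auto simp: compact_space_def)
  then have E_sub: "?E \<subseteq> topspace ?X"
    unfolding E using compactin_subset_topspace by blast
  have K_mono: "K \<gamma> \<subseteq> K \<beta>" if "\<gamma> \<le> \<beta>" for \<gamma> \<beta>
  proof
    fix z assume "z \<in> K \<gamma>"
    then obtain x where "x \<in> points ?F \<gamma>" "z = emb limit \<gamma> x"
      by (auto simp: K_def X_omega1_def)
    then have "z = emb limit \<beta> (link ?F \<beta> \<gamma> x)" "link ?F \<beta> \<gamma> x \<in> points ?F \<beta>"
      using emb_limit_emb[of \<beta> \<gamma> x] link_in[of \<beta> \<gamma> x] that by (auto simp: link_def)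
    then show "z \<in> K \<beta>"
      by (auto simp: K_def X_omega1_def)
  qed
  assume "metrizable_space (subtopology ?X ?E)"
  moreover have "compactin (subtopology ?X ?E) S" if "S \<in> range K" for S
    using that K_compact by (auto simp: compactin_subtopology E)
  moreover have "\<exists>S\<in>range K. C \<subseteq> S" if "countable C" "C \<subseteq> topspace (subtopology ?X ?E)" for C
  proof -
    have "\<forall>z\<in>C. \<exists>\<alpha>. z \<in> K \<alpha>"
      using that E by auto
    then obtain r where r: "\<And>z. z \<in> C \<Longrightarrow> z \<in> K (r z)"
      by metis
    obtain \<beta> where "\<And>\<alpha>. \<alpha> \<in> r ` C \<Longrightarrow> \<alpha> < \<beta>"
      using countable_bounded_omega1[OF countable_image[OF \<open>countable C\<close>, of r]] by blast
    then have "C \<subseteq> K \<beta>"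
      using r K_mono by (metis image_eqI less_imp_le subset_eq)
    then show ?thesis
      by blast
  qed
  ultimately have "topspace (subtopology ?X ?E) \<in> range K"
    by (rule metrizable_compact_exhaustion)
  then obtain \<beta> where \<beta>: "?E = K \<beta>"
    using E_sub by (auto simp: Int_absorb1)
  obtain \<alpha> where succ: "is_succ_of \<alpha> \<beta>"
    by (rule succ_exists_omega1)
  then have less: "\<beta> \<le> \<alpha>" "\<not> \<alpha> \<le> \<beta>"
    by (auto simp: is_succ_of_def not_le)
  let ?a = "a_of (?F \<alpha>)"
  \<comment> \<open>The coordinate \<open>\<alpha>\<close> of a thread in the image of \<open>X(\<beta>)\<close> lies in the bottom copy of \<open>X(\<beta>)\<close>.\<close>
  have "emb limit \<alpha> ?a \<in> K \<beta>"
    using coherentD(3)[OF coherent, of \<alpha>] \<beta>[symmetric] by (auto simp: E K_def X_omega1_def)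
  then obtain y where "emb limit \<alpha> ?a = emb limit \<beta> y"
    by (auto simp: K_def X_omega1_def)
  then have "link ?F \<alpha> \<alpha> ?a = link ?F \<alpha> \<beta> y"
    using bond_limit_emb by (metis UNIV_I)
  then have "cls (?F \<beta>) (a_of (?F \<beta>), 1) = cls (?F \<beta>) (emb (?F \<beta>) \<beta> y, 0)"
    using less by (simp add: link_def X_stage_succ[OF succ] succ_stage_def)
  then show False
    by (auto simp: cls_eq_iff dest: glue_zero)
qed

end
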